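(* The class of languages accepted by register set automata is closed under union and intersection, and is not closed under complement (i.e., there is an RsA $\mathcal{A}$ such that no RsA accepts $(\Sigma\times\mathbb{D})^*\setminus L(\mathcal{A})$).
   Context: Fix a finite nonempty alphabet $\Sigma$ and an infinite data domain $\mathbb{D}$. A register set automaton (RsA) is a tuple $(Q,R,\Delta,I,F)$ with $Q$ finite states, $R$ finite registers, $I,F\subseteq Q$, and transitions $q\xrightarrow{a\mid G^{\in},G^{\notin},up}s$ with $a\in\Sigma$, $G^{\in},G^{\notin}\subseteq R$ disjoint, $up\colon R\to 2^{R\cup\{\mathit{in}\}}$. Configurations are $(q,f)$ with $f\colon R\to 2^{\mathbb{D}}$; initial ones have $q\in I$ and all registers empty. A step over $(a,d)$ is possible iff $d\in f(r)$ for all $r\in G^{\in}$ and $d\notin f(r)$ for all $r\in G^{\notin}$; afterwards each register $r$ holds $\bigcup\{f(r')\mid r'\in R\cap up(r)\}$, plus $d$ if $\mathit{in}\in up(r)$. $L(\mathcal{A})\subseteq(\Sigma\times\mathbb{D})^*$ is the set of words with a run from an initial configuration ending in $F$. *)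

theory Defs
  imports Main "HOL-Library.FuncSet"
begin

text \<open>The alphabet is a type \<open>'a\<close> of class \<open>finite\<close>, the data domain a type \<open>'d\<close>,
  assumed infinite where needed.\<close>

datatype 'r source = Reg 'r | In

record ('q, 'r, 'a) rsa =
  states :: "'q set"
  regs   :: "'r set"
  trans  :: "('q \<times> 'a \<times> 'r set \<times> 'r set \<times> ('r \<Rightarrow> 'r source set) \<times> 'q) set"
  init   :: "'q set"
  final  :: "'q set"

text \<open>Update functions and register valuations are functions on \<^term>\<open>regs A\<close> only,
  rendered as extensional functions (\<open>undefined\<close> outside \<^term>\<open>regs A\<close>).\<close>

definition is_rsa :: "('q, 'r, 'a) rsa \<Rightarrow> bool" where
  "is_rsa A \<longleftrightarrow>
     finite (states A) \<and> finite (regs A) \<and> init A \<subseteq> states A \<and> final A \<subseteq> states A \<and>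
     (\<forall>(q, a, Gin, Gnotin, up, s) \<in> trans A.
        q \<in> states A \<and> s \<in> states A \<and> Gin \<subseteq> regs A \<and> Gnotin \<subseteq> regs A \<and> Gin \<inter> Gnotin = {} \<and>
        up \<in> regs A \<rightarrow>\<^sub>E Pow (Reg ` regs A \<union> {In}))"

type_synonym ('q, 'r, 'd) config = "'q \<times> ('r \<Rightarrow> 'd set)"

definition initial_configs :: "('q, 'r, 'a) rsa \<Rightarrow> ('q, 'r, 'd) config set" where
  "initial_configs A = {(q, \<lambda>r\<in>regs A. {}) | q. q \<in> init A}"

definition update ::
  "'r set \<Rightarrow> ('r \<Rightarrow> 'r source set) \<Rightarrow> 'd \<Rightarrow> ('r \<Rightarrow> 'd set) \<Rightarrow> 'r \<Rightarrow> 'd set" where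
  "update R up d f =
     (\<lambda>r\<in>R. \<Union> {f r' | r'. r' \<in> R \<and> Reg r' \<in> up r} \<union> (if In \<in> up r then {d} else {}))"

inductive step ::
  "('q, 'r, 'a) rsa \<Rightarrow> ('q, 'r, 'd) config \<Rightarrow> 'a \<times> 'd \<Rightarrow> ('q, 'r, 'd) config \<Rightarrow> bool"
  for A where
  "\<lbrakk>(q, a, Gin, Gnotin, up, s) \<in> trans A; \<forall>r\<in>Gin. d \<in> f r; \<forall>r\<in>Gnotin. d \<notin> f r\<rbrakk>
   \<Longrightarrow> step A (q, f) (a, d) (s, update (regs A) up d f)"

inductive run ::
  "('q, 'r, 'a) rsa \<Rightarrow> ('q, 'r, 'd) config \<Rightarrow> ('a \<times> 'd) list \<Rightarrow> ('q, 'r, 'd) config \<Rightarrow> bool"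
  for A where
  run_Nil: "run A c [] c"
| run_Cons: "step A c x c' \<Longrightarrow> run A c' w c'' \<Longrightarrow> run A c (x # w) c''"

definition lang :: "('q, 'r, 'a) rsa \<Rightarrow> ('a \<times> 'd) list set" where
  "lang A = {w. \<exists>c\<in>initial_configs A. \<exists>q f. run A c w (q, f) \<and> q \<in> final A}"

text \<open>HOL cannot quantify over the types of states and registers, so the class of languages is
  defined through automata with states and registers in \<^typ>\<open>nat\<close>. Lemma
  \<open>lang_in_rsa_langs\<close> below shows that this loses no automaton over any other types.\<close>

definition rsa_langs :: "('a \<times> 'd) list set set" where
  "rsa_langs = {lang A | A :: (nat, nat, 'a) rsa. is_rsa A}"

definition rename :: "('q \<Rightarrow> 'p) \<Rightarrow> ('r \<Rightarrow> 's) \<Rightarrow> ('q, 'r, 'a) rsa \<Rightarrow> ('p, 's, 'a) rsa" where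
  "rename h g A =
     \<lparr>states = h ` states A, regs = g ` regs A,
      trans = (\<lambda>(q, a, Gin, Gnotin, up, s).
        (h q, a, g ` Gin, g ` Gnotin,
         \<lambda>r\<in>g ` regs A. map_source g ` up (inv_into (regs A) g r), h s)) ` trans A,
      init = h ` init A, final = h ` final A\<rparr>"

definition rename_config ::
  "('q \<Rightarrow> 'p) \<Rightarrow> ('r \<Rightarrow> 's) \<Rightarrow> 'r set \<Rightarrow> ('q, 'r, 'd) config \<Rightarrow> ('p, 's, 'd) config" where
  "rename_config h g R = (\<lambda>(q, f). (h q, \<lambda>r\<in>g ` R. f (inv_into R g r)))"

context
  fixes A :: "('q, 'r, 'a) rsa" and h :: "'q \<Rightarrow> 'p" and g :: "'r \<Rightarrow> 's"
  assumes A: "is_rsa A" and h: "inj_on h (states A)" and g: "inj_on g (regs A)"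
begin

lemma is_rsa_rename: "is_rsa (rename h g A)"
proof -
  have up: "map_source g ` up (inv_into (regs A) g (g r)) \<subseteq> Reg ` g ` regs A \<union> {In}"
    if "up \<in> regs A \<rightarrow>\<^sub>E Pow (Reg ` regs A \<union> {In})" "r \<in> regs A" for up r
  proof -
    have "up r \<subseteq> Reg ` regs A \<union> {In}" using that by (auto simp: PiE_iff)
    then show ?thesis using that g by auto
  qed
  have dj: "g ` X \<inter> g ` Y = {}" if "X \<subseteq> regs A" "Y \<subseteq> regs A" "X \<inter> Y = {}" for X Y
    using that g by (metis image_empty inj_on_image_Int)
  show ?thesis
    unfolding is_rsa_def
  proof (intro conjI ballI)
    fix t assume "t \<in> trans (rename h g A)"
    then obtain q a Gin Gnotin up s where m: "(q, a, Gin, Gnotin, up, s) \<in> trans A"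
      and t: "t = (h q, a, g ` Gin, g ` Gnotin,
         \<lambda>r\<in>g ` regs A. map_source g ` up (inv_into (regs A) g r), h s)"
      by (auto simp: rename_def)
    have w: "q \<in> states A" "s \<in> states A" "Gin \<subseteq> regs A" "Gnotin \<subseteq> regs A" "Gin \<inter> Gnotin = {}"
      "up \<in> regs A \<rightarrow>\<^sub>E Pow (Reg ` regs A \<union> {In})"
      using A m by (auto simp: is_rsa_def dest!: bspec)
    have "(\<lambda>r\<in>g ` regs A. map_source g ` up (inv_into (regs A) g r))
        \<in> g ` regs A \<rightarrow>\<^sub>E Pow (Reg ` g ` regs A \<union> {In})"
      using up[OF w(6)] by (intro restrict_PiE_iff[THEN iffD2]) blast
    then show "case t of (q, a, Gin, Gnotin, up, s) \<Rightarrow>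
        q \<in> states (rename h g A) \<and> s \<in> states (rename h g A) \<and>
        Gin \<subseteq> regs (rename h g A) \<and> Gnotin \<subseteq> regs (rename h g A) \<and> Gin \<inter> Gnotin = {} \<and>
        up \<in> regs (rename h g A) \<rightarrow>\<^sub>E Pow (Reg ` regs (rename h g A) \<union> {In})"
      using w dj[OF w(3-5)] by (auto simp: t rename_def)
  qed (use A in \<open>auto simp: rename_def is_rsa_def\<close>)
qed

lemma update_rename:
  assumes "up \<in> regs A \<rightarrow>\<^sub>E Pow (Reg ` regs A \<union> {In})"
  shows "update (g ` regs A) (\<lambda>r\<in>g ` regs A. map_source g ` up (inv_into (regs A) g r)) d
      (\<lambda>r\<in>g ` regs A. f (inv_into (regs A) g r))
    = (\<lambda>r\<in>g ` regs A. update (regs A) up d f (inv_into (regs A) g r))"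
proof (rule ext)
  fix x
  show "update (g ` regs A) (\<lambda>r\<in>g ` regs A. map_source g ` up (inv_into (regs A) g r)) d
      (\<lambda>r\<in>g ` regs A. f (inv_into (regs A) g r)) x
    = (\<lambda>r\<in>g ` regs A. update (regs A) up d f (inv_into (regs A) g r)) x"
  proof (cases "x \<in> g ` regs A")
    case True
    then obtain r where r: "r \<in> regs A" "x = g r" by auto
    have upr: "up r \<subseteq> Reg ` regs A \<union> {In}" using assms r by (auto simp: PiE_iff)
    have i: "In \<in> map_source g ` up r \<longleftrightarrow> In \<in> up r"
    proof
      assume "In \<in> map_source g ` up r"
      then obtain y where "y \<in> up r" "In = map_source g y" by auto
      then show "In \<in> up r" by (cases y) auto
    next
      assume "In \<in> up r" then show "In \<in> map_source g ` up r" by force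
    qed
    have j: "Reg (g r') \<in> map_source g ` up r \<longleftrightarrow> Reg r' \<in> up r" if r': "r' \<in> regs A" for r'
    proof
      assume "Reg (g r') \<in> map_source g ` up r"
      then obtain y where y: "y \<in> up r" "Reg (g r') = map_source g y" by auto
      then obtain z where z: "y = Reg z" "g r' = g z" by (cases y) auto
      then have "z \<in> regs A" using upr y by auto
      then show "Reg r' \<in> up r" using z y g r' by (auto dest: inj_onD)
    next
      assume "Reg r' \<in> up r" then show "Reg (g r') \<in> map_source g ` up r" by force
    qed
    have "{(\<lambda>r\<in>g ` regs A. f (inv_into (regs A) g r)) r' | r'.
             r' \<in> g ` regs A \<and> Reg r' \<in> map_source g ` up r}
        = (\<lambda>r'. (\<lambda>r\<in>g ` regs A. f (inv_into (regs A) g r)) (g r')) `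
            {r' \<in> regs A. Reg (g r') \<in> map_source g ` up r}"
      by blast
    also have "\<dots> = f ` {r' \<in> regs A. Reg r' \<in> up r}"
      using j g by (intro image_cong) auto
    also have "\<dots> = {f r' | r'. r' \<in> regs A \<and> Reg r' \<in> up r}" by blast
    finally have "{(\<lambda>r\<in>g ` regs A. f (inv_into (regs A) g r)) r' | r'.
             r' \<in> g ` regs A \<and> Reg r' \<in> map_source g ` up r}
        = {f r' | r'. r' \<in> regs A \<and> Reg r' \<in> up r}" .
    then show ?thesis using r g i by (simp add: update_def)
  next
    case False then show ?thesis by (simp add: update_def)
  qed
qed

lemma step_rename:
  assumes "step A c x c'"
  shows "step (rename h g A) (rename_config h g (regs A) c) x (rename_config h g (regs A) c')"
  using assms
proof cases
  case (1 q a Gin Gnotin up s d f)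
  have w: "Gin \<subseteq> regs A" "Gnotin \<subseteq> regs A" "up \<in> regs A \<rightarrow>\<^sub>E Pow (Reg ` regs A \<union> {In})"
    using A 1 by (auto simp: is_rsa_def dest!: bspec)
  let ?f = "\<lambda>r\<in>g ` regs A. f (inv_into (regs A) g r)"
  let ?up = "\<lambda>r\<in>g ` regs A. map_source g ` up (inv_into (regs A) g r)"
  have "step (rename h g A) (h q, ?f) (a, d) (h s, update (regs (rename h g A)) ?up d ?f)"
  proof (rule step.intros)
    show "(h q, a, g ` Gin, g ` Gnotin, ?up, h s) \<in> trans (rename h g A)"
      using 1 by (force simp: rename_def)
  qed (use 1 w g in \<open>auto simp: subset_iff\<close>)
  then show ?thesis
    using 1 by (simp add: rename_config_def rename_def update_rename[OF w(3)])
qed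

lemma step_renameD:
  assumes "step (rename h g A) (rename_config h g (regs A) (q, f)) x c'" "q \<in> states A"
  shows "\<exists>s f'. s \<in> states A \<and> c' = rename_config h g (regs A) (s, f') \<and> step A (q, f) x (s, f')"
  using assms(1)
proof cases
  case (1 q1 a G1 G2 up1 s1 d f1)
  from 1(4) obtain q0 Gin Gnotin up s where m: "(q0, a, Gin, Gnotin, up, s) \<in> trans A"
      and e: "q1 = h q0" "G1 = g ` Gin" "G2 = g ` Gnotin" "s1 = h s"
        "up1 = (\<lambda>r\<in>g ` regs A. map_source g ` up (inv_into (regs A) g r))"
      by (auto simp: rename_def)
  have w: "Gin \<subseteq> regs A" "Gnotin \<subseteq> regs A" "up \<in> regs A \<rightarrow>\<^sub>E Pow (Reg ` regs A \<union> {In})"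
    "q0 \<in> states A" "s \<in> states A"
    using A m by (auto simp: is_rsa_def dest!: bspec)
  have q: "q0 = q" and f1: "f1 = (\<lambda>r\<in>g ` regs A. f (inv_into (regs A) g r))"
    using 1(1) e w assms(2) h by (auto simp: rename_config_def dest: inj_onD)
  have "step A (q, f) (a, d) (s, update (regs A) up d f)"
    using m unfolding q
    by (rule step.intros) (use 1 e f1 w g in \<open>auto simp: subset_iff\<close>)
  moreover have "c' = rename_config h g (regs A) (s, update (regs A) up d f)"
    using 1(3) e f1 by (simp add: rename_config_def rename_def update_rename[OF w(3)])
  ultimately show ?thesis using 1(2) w(5) by blast
qed

lemma run_rename:
  "run A c w c' \<Longrightarrow>
   run (rename h g A) (rename_config h g (regs A) c) w (rename_config h g (regs A) c')"
  by (induction rule: run.induct) (auto intro: run.intros step_rename)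

lemma run_renameD:
  assumes "run (rename h g A) (rename_config h g (regs A) (q, f)) w c'" "q \<in> states A"
  shows "\<exists>s f'. s \<in> states A \<and> c' = rename_config h g (regs A) (s, f') \<and> run A (q, f) w (s, f')"
  using assms
proof (induction w arbitrary: q f)
  case Nil
  then show ?case by (auto elim: run.cases intro: run.intros)
next
  case (Cons x w)
  from Cons.prems(1) obtain c1 where
    "step (rename h g A) (rename_config h g (regs A) (q, f)) x c1" "run (rename h g A) c1 w c'"
    by (auto elim: run.cases)
  then show ?case
    using step_renameD[OF _ Cons.prems(2)] Cons.IH by (blast intro: run.intros)
qed

lemma lang_rename: "(lang (rename h g A) :: ('a \<times> 'd) list set) = lang A"
proof -
  have sub: "init A \<subseteq> states A" "final A \<subseteq> states A" using A by (auto simp: is_rsa_def)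
  have "rename_config h g (regs A) (q, \<lambda>r\<in>regs A. {}) = (h q, \<lambda>r\<in>g ` regs A. {} :: 'd set)" for q
    by (auto simp: rename_config_def inv_into_into intro!: restrict_ext)
  then have ini: "(initial_configs (rename h g A) :: ('p, 's, 'd) config set)
      = rename_config h g (regs A) ` initial_configs A"
    by (auto simp: initial_configs_def rename_def image_iff)
  show ?thesis
  proof (intro equalityI subsetI)
    fix w :: "('a \<times> 'd) list" assume "w \<in> lang A"
    then obtain c q f where "c \<in> initial_configs A" "run A c w (q, f)" "q \<in> final A"
      by (auto simp: lang_def)
    then have "rename_config h g (regs A) c \<in> initial_configs (rename h g A)"
      "run (rename h g A) (rename_config h g (regs A) c) w (rename_config h g (regs A) (q, f))"
      "h q \<in> final (rename h g A)"
      by (auto simp: ini intro: run_rename) (auto simp: rename_def)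
    then show "w \<in> lang (rename h g A)"
      by (auto simp: lang_def rename_config_def)
  next
    fix w :: "('a \<times> 'd) list" assume "w \<in> lang (rename h g A)"
    then obtain q0 f0 p f where i: "(q0, f0) \<in> initial_configs A"
      and r: "run (rename h g A) (rename_config h g (regs A) (q0, f0)) w (p, f)"
      and p: "p \<in> h ` final A"
      by (auto simp: lang_def ini) (auto simp: rename_def)
    have "q0 \<in> states A" using i sub by (auto simp: initial_configs_def)
    from run_renameD[OF r this] obtain s f' where
      "s \<in> states A" "(p, f) = rename_config h g (regs A) (s, f')" "run A (q0, f0) w (s, f')"
      by blast
    moreover from this have "s \<in> final A"
      using p sub h by (auto simp: rename_config_def dest: inj_onD)
    ultimately show "w \<in> lang A" using i by (auto simp: lang_def)
  qed
qed

end

lemma lang_in_rsa_langs: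
  fixes A :: "('q, 'r, 'a) rsa"
  assumes "is_rsa A"
  shows "lang A \<in> rsa_langs"
proof -
  have "finite (states A)" "finite (regs A)" using assms by (auto simp: is_rsa_def)
  then obtain h :: "'q \<Rightarrow> nat" and g :: "'r \<Rightarrow> nat"
    where "inj_on h (states A)" "inj_on g (regs A)"
    using finite_imp_inj_to_nat_seg by metis
  then show ?thesis
    using is_rsa_rename[OF assms] lang_rename[OF assms] unfolding rsa_langs_def by blast
qed

end

theory Submission
  imports Defs "HOL.Topological_Spaces"
begin

text \<open>Union and intersection are the usual sum and product constructions on disjoint register
  sets.  For the complement, consider the words in which some data value occurs exactly once.  An
  automaton for the complement, where every value is repeated, would accept
  \<open>e\<^sub>0 \<dots> e\<^sub>n\<^sub>-\<^sub>1 e\<^sub>0 \<dots> e\<^sub>n\<^sub>-\<^sub>1\<close> for all \<open>n\<close>.  A continuation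
  from a configuration \<open>(q, f)\<close> depends on a value \<open>d\<close> only through its type
  \<open>{r. d \<in> f r}\<close>.  By Dickson's lemma there are \<open>n < m\<close> for which the automaton is in the same
  state after the first half and each type has at least as many values for \<open>m\<close> as for \<open>n\<close>.  So the
  second half for \<open>n\<close>, with its values renamed along an injection preserving types, is accepted
  after the first half for \<open>m\<close>, although some of the \<open>m\<close> values are then not repeated.\<close>

section \<open>Acceptance from a configuration\<close>

text \<open>Recursion on the word lets simulations between automata be stated as one-step
  equivalences and lifted by induction on the word.\<close>

primrec accepts :: "('q, 'r, 'a) rsa \<Rightarrow> ('a \<times> 'd) list \<Rightarrow> ('q, 'r, 'd) config \<Rightarrow> bool" where
  "accepts A [] c \<longleftrightarrow> fst c \<in> final A"
| "accepts A (x # w) c \<longleftrightarrow> (\<exists>c'. step A c x c' \<and> accepts A w c')"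

lemma run_Nil_iff [simp]: "run A c [] c' \<longleftrightarrow> c' = c"
  by (auto elim: run.cases intro: run.intros)

lemma run_Cons_iff [simp]: "run A c (x # w) c'' \<longleftrightarrow> (\<exists>c'. step A c x c' \<and> run A c' w c'')"
  by (blast elim: run.cases intro: run.intros)

text \<open>Cutting at an arbitrary position exposes the configuration reached there, so that a
  different continuation can be glued to the same first half.\<close>

lemma accepts_append: "accepts A (u @ v) c \<longleftrightarrow> (\<exists>c'. run A c u c' \<and> accepts A v c')"
  by (induction u arbitrary: c) auto

lemma accepts_iff_run: "accepts A w c \<longleftrightarrow> (\<exists>q f. run A c w (q, f) \<and> q \<in> final A)"
  using accepts_append[of A w "[]" c] by auto

lemma lang_eq_accepts: "lang A = {w. \<exists>q\<in>init A. accepts A w (q, \<lambda>r\<in>regs A. {})}"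
  by (auto simp: lang_def initial_configs_def accepts_iff_run)

lemma step_iff:
  "step A (q, f) (a, d) c \<longleftrightarrow>
    (\<exists>Gin Gnotin up s. (q, a, Gin, Gnotin, up, s) \<in> trans A \<and> (\<forall>r\<in>Gin. d \<in> f r) \<and>
       (\<forall>r\<in>Gnotin. d \<notin> f r) \<and> c = (s, update (regs A) up d f))"
  by (blast elim: step.cases intro: step.intros)

lemma transD:
  assumes "is_rsa A" "(q, a, Gin, Gnotin, up, s) \<in> trans A"
  shows "q \<in> states A" "s \<in> states A" "Gin \<subseteq> regs A" "Gnotin \<subseteq> regs A" "Gin \<inter> Gnotin = {}"
    "up \<in> regs A \<rightarrow>\<^sub>E Pow (Reg ` regs A \<union> {In})"
  using assms by (auto simp: is_rsa_def dest!: bspec)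

lemma step_states: "is_rsa A \<Longrightarrow> step A c x c' \<Longrightarrow> fst c' \<in> states A"
  by (auto elim!: step.cases dest: transD)

text \<open>Every step ends in a state of the automaton. The states reached halfway thus come from
  one finite set, as the comparison by Dickson's lemma requires.\<close>

lemma run_states: "run A c w c' \<Longrightarrow> is_rsa A \<Longrightarrow> fst c \<in> states A \<Longrightarrow> fst c' \<in> states A"
  by (induction rule: run.induct) (auto dest: step_states)

section \<open>Automata on disjoint sets of registers\<close>

text \<open>The restriction keeps the valuation extensional and makes it depend on \<open>f\<close>
  and \<open>g\<close> only through their values on \<open>R\<close> and \<open>S\<close>. An empty
  half may therefore be written \<open>\<lambda>_. {}\<close>.\<close>

definition join_val :: "'r set \<Rightarrow> 's set \<Rightarrow> ('r \<Rightarrow> 'd set) \<Rightarrow> ('s \<Rightarrow> 'd set) \<Rightarrow> 'r + 's \<Rightarrow> 'd set" where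
  "join_val R S f g = (\<lambda>x\<in>R <+> S. case_sum f g x)"

definition join_up ::
  "'r set \<Rightarrow> 's set \<Rightarrow> ('r \<Rightarrow> 'r source set) \<Rightarrow> ('s \<Rightarrow> 's source set) \<Rightarrow> 'r + 's \<Rightarrow> ('r + 's) source set"
  where
  "join_up R S u v =
     (\<lambda>x\<in>R <+> S. case x of Inl r \<Rightarrow> map_source Inl ` u r | Inr s \<Rightarrow> map_source Inr ` v s)"

lemma Plus_simps [simp]:
  "Inl x \<in> X <+> Y \<longleftrightarrow> x \<in> X"
  "Inr y \<in> X <+> Y \<longleftrightarrow> y \<in> Y"
  "(\<forall>z\<in>X <+> Y. P z) \<longleftrightarrow> (\<forall>x\<in>X. P (Inl x)) \<and> (\<forall>y\<in>Y. P (Inr y))"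
  "(\<exists>z\<in>X <+> Y. P z) \<longleftrightarrow> (\<exists>x\<in>X. P (Inl x)) \<or> (\<exists>y\<in>Y. P (Inr y))"
  by auto

lemma map_source_mem [simp]:
  "In \<in> map_source g ` X \<longleftrightarrow> In \<in> X"
  "Reg (Inl r) \<in> map_source Inl ` Y \<longleftrightarrow> Reg r \<in> Y"
  "Reg (Inr s) \<in> map_source Inr ` Z \<longleftrightarrow> Reg s \<in> Z"
  "Reg (Inr s) \<notin> map_source Inl ` Y"
  "Reg (Inl r) \<notin> map_source Inr ` Z"
proof -
  have *: "y \<in> map_source g ` X \<longleftrightarrow>
      (case y of In \<Rightarrow> In \<in> X | Reg z \<Rightarrow> \<exists>x. Reg x \<in> X \<and> z = g x)" for y :: "'g source" and g :: "'h \<Rightarrow> 'g" and X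
  proof
    assume "y \<in> map_source g ` X"
    then obtain x where "x \<in> X" "y = map_source g x" by auto
    then show "case y of In \<Rightarrow> In \<in> X | Reg z \<Rightarrow> \<exists>x. Reg x \<in> X \<and> z = g x" by (cases x) auto
  qed (force split: source.splits)
  show "In \<in> map_source g ` X \<longleftrightarrow> In \<in> X"
    "Reg (Inl r) \<in> map_source Inl ` Y \<longleftrightarrow> Reg r \<in> Y"
    "Reg (Inr s) \<in> map_source Inr ` Z \<longleftrightarrow> Reg s \<in> Z"
    "Reg (Inr s) \<notin> map_source Inl ` Y"
    "Reg (Inl r) \<notin> map_source Inr ` Z"
    by (simp_all add: *)
qed

lemma mem_update:
  "x \<in> update R up d f r \<longleftrightarrow>
    (\<exists>r'\<in>R. Reg r' \<in> up r \<and> x \<in> f r') \<or> In \<in> up r \<and> x = d" if "r \<in> R"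
  using that by (auto simp: update_def)

lemma mem_join_val [simp]:
  "r \<in> R \<Longrightarrow> join_val R S f g (Inl r) = f r"
  "s \<in> S \<Longrightarrow> join_val R S f g (Inr s) = g s"
  by (simp_all add: join_val_def)

lemma join_val_cong:
  "(\<And>r. r \<in> R \<Longrightarrow> f r = f' r) \<Longrightarrow> (\<And>s. s \<in> S \<Longrightarrow> g s = g' s) \<Longrightarrow>
    join_val R S f g = join_val R S f' g'"
  by (auto simp: join_val_def fun_eq_iff split: sum.split)

text \<open>These are the shapes of the initial valuation that the acceptance lemmas expect for the
  product and for the left and right side of the sum.\<close>

lemma join_val_empty:
  "(\<lambda>x\<in>R <+> S. {}) = join_val R S (\<lambda>r\<in>R. {}) (\<lambda>s\<in>S. {})"
  "(\<lambda>x\<in>R <+> S. {}) = join_val R S (\<lambda>r\<in>R. {}) (\<lambda>_. {})"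
  "(\<lambda>x\<in>R <+> S. {}) = join_val R S (\<lambda>_. {}) (\<lambda>s\<in>S. {})"
  by (auto simp: join_val_def fun_eq_iff split: sum.split)

text \<open>All register sources in \<open>join_up\<close> carry the tag of the register being
  updated, so no value crosses between the two halves.\<close>

lemma update_join:
  "update (R <+> S) (join_up R S u v) d (join_val R S f g)
    = join_val R S (update R u d f) (update S v d g)"
proof (rule ext)
  fix x
  show "update (R <+> S) (join_up R S u v) d (join_val R S f g) x
      = join_val R S (update R u d f) (update S v d g) x"
  proof (cases "x \<in> R <+> S")
    case True
    then show ?thesis
      by (intro set_eqI) (auto simp: mem_update join_up_def)
  qed (simp add: update_def join_val_def)
qed

lemma join_up_PiE:
  assumes "\<And>r. r \<in> R \<Longrightarrow> u r \<subseteq> Reg ` R \<union> {In}" "\<And>s. s \<in> S \<Longrightarrow> v s \<subseteq> Reg ` S \<union> {In}"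
  shows "join_up R S u v \<in> R <+> S \<rightarrow>\<^sub>E Pow (Reg ` (R <+> S) \<union> {In})"
  unfolding join_up_def
proof (intro restrict_PiE_iff[THEN iffD2] ballI)
  fix x assume "x \<in> R <+> S"
  then show "(case x of Inl r \<Rightarrow> map_source Inl ` u r | Inr s \<Rightarrow> map_source Inr ` v s)
      \<in> Pow (Reg ` (R <+> S) \<union> {In})"
  proof (cases x)
    case (Inl r)
    then have "map_source Inl ` u r \<subseteq> map_source Inl ` (Reg ` R \<union> {In})"
      using \<open>x \<in> R <+> S\<close> by (intro image_mono assms(1)) simp
    then show ?thesis by (auto simp: Inl)
  next
    case (Inr s)
    then have "map_source Inr ` v s \<subseteq> map_source Inr ` (Reg ` S \<union> {In})"
      using \<open>x \<in> R <+> S\<close> by (intro image_mono assms(2)) simp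
    then show ?thesis by (auto simp: Inr)
  qed
qed

section \<open>Intersection\<close>

definition inter_rsa ::
  "('q, 'r, 'a) rsa \<Rightarrow> ('p, 's, 'a) rsa \<Rightarrow> ('q \<times> 'p, 'r + 's, 'a) rsa" where
  "inter_rsa A B =
     \<lparr>states = states A \<times> states B, regs = regs A <+> regs B,
      trans = {((q, p), a, G <+> H, G' <+> H', join_up (regs A) (regs B) u v, (s, t))
        | q p a G H G' H' u v s t. (q, a, G, G', u, s) \<in> trans A \<and> (p, a, H, H', v, t) \<in> trans B},
      init = init A \<times> init B, final = final A \<times> final B\<rparr>"

lemma is_rsa_inter:
  assumes "is_rsa A" "is_rsa B"
  shows "is_rsa (inter_rsa A B)"
proof -
  have "(q, p) \<in> states (inter_rsa A B) \<and> (s, t) \<in> states (inter_rsa A B) \<and>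
      G <+> H \<subseteq> regs (inter_rsa A B) \<and> G' <+> H' \<subseteq> regs (inter_rsa A B) \<and>
      (G <+> H) \<inter> (G' <+> H') = {} \<and>
      join_up (regs A) (regs B) u v
        \<in> regs (inter_rsa A B) \<rightarrow>\<^sub>E Pow (Reg ` regs (inter_rsa A B) \<union> {In})"
    if "(q, a, G, G', u, s) \<in> trans A" "(p, a, H, H', v, t) \<in> trans B" for q p a G H G' H' u v s t
  proof -
    note w = transD[OF assms(1) that(1)] transD[OF assms(2) that(2)]
    have "join_up (regs A) (regs B) u v
        \<in> regs A <+> regs B \<rightarrow>\<^sub>E Pow (Reg ` (regs A <+> regs B) \<union> {In})"
      using w(6,12) by (intro join_up_PiE) (auto simp: PiE_iff)
    then show ?thesis
      using w(1-5,7-11) by (auto simp: inter_rsa_def)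
  qed
  note * = this
  have "case x of (q, a, Gin, Gnotin, up, s) \<Rightarrow>
        q \<in> states (inter_rsa A B) \<and> s \<in> states (inter_rsa A B) \<and>
        Gin \<subseteq> regs (inter_rsa A B) \<and> Gnotin \<subseteq> regs (inter_rsa A B) \<and> Gin \<inter> Gnotin = {} \<and>
        up \<in> regs (inter_rsa A B) \<rightarrow>\<^sub>E Pow (Reg ` regs (inter_rsa A B) \<union> {In})"
    if x: "x \<in> trans (inter_rsa A B)" for x
  proof -
    obtain q p a G H G' H' u v s t where
      "x = ((q, p), a, G <+> H, G' <+> H', join_up (regs A) (regs B) u v, (s, t))"
      "(q, a, G, G', u, s) \<in> trans A" "(p, a, H, H', v, t) \<in> trans B"
      using x by (auto simp: inter_rsa_def)
    then show ?thesis using * by simp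
  qed
  moreover have "finite (states (inter_rsa A B))" "finite (regs (inter_rsa A B))"
    "init (inter_rsa A B) \<subseteq> states (inter_rsa A B)" "final (inter_rsa A B) \<subseteq> states (inter_rsa A B)"
    using assms by (auto simp: is_rsa_def inter_rsa_def)
  ultimately show ?thesis unfolding is_rsa_def by blast
qed

text \<open>Both components read the same letter and data value, and guards and updates act on each
  half separately. Joined valuations lead to joined valuations, so the equivalence can be iterated
  along a word.\<close>

lemma step_inter:
  assumes "is_rsa A" "is_rsa B"
  shows "step (inter_rsa A B) ((q, p), join_val (regs A) (regs B) f g) x c \<longleftrightarrow>
    (\<exists>s f' t g'. step A (q, f) x (s, f') \<and> step B (p, g) x (t, g') \<and>
       c = ((s, t), join_val (regs A) (regs B) f' g'))" (is "?L \<longleftrightarrow> ?R")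
proof (cases x)
  case (Pair a d)
  \<comment> \<open>By well-formedness the guards mention only registers of their own automaton,
    where \<open>join_val\<close> agrees with \<open>f\<close> or \<open>g\<close>.\<close>
  have guards: "(\<forall>r\<in>G <+> H. d \<in> join_val (regs A) (regs B) f g r)
        \<longleftrightarrow> (\<forall>r\<in>G. d \<in> f r) \<and> (\<forall>r\<in>H. d \<in> g r)"
      "(\<forall>r\<in>G' <+> H'. d \<notin> join_val (regs A) (regs B) f g r)
        \<longleftrightarrow> (\<forall>r\<in>G'. d \<notin> f r) \<and> (\<forall>r\<in>H'. d \<notin> g r)"
    if "(q, a, G, G', u, s) \<in> trans A" "(p, a, H, H', v, t) \<in> trans B" for G H G' H' u v s t
    using transD(3,4)[OF assms(1) that(1)] transD(3,4)[OF assms(2) that(2)]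
    by (auto simp: subset_iff)
  show ?thesis
  proof
    assume ?L
    then obtain G H G' H' u v s t where tr: "(q, a, G, G', u, s) \<in> trans A" "(p, a, H, H', v, t) \<in> trans B"
      and g: "\<forall>r\<in>G <+> H. d \<in> join_val (regs A) (regs B) f g r"
        "\<forall>r\<in>G' <+> H'. d \<notin> join_val (regs A) (regs B) f g r"
      and c: "c = ((s, t), update (regs A <+> regs B) (join_up (regs A) (regs B) u v) d
        (join_val (regs A) (regs B) f g))"
      unfolding Pair step_iff by (auto simp: inter_rsa_def simp del: Plus_simps)
    have "step A (q, f) (a, d) (s, update (regs A) u d f)"
      "step B (p, g) (a, d) (t, update (regs B) v d g)"
      using tr g guards[OF tr] by (auto intro: step.intros)
    then show ?R unfolding Pair c update_join by blast
  next
    assume ?R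
    then obtain G G' u s H H' v t where tr: "(q, a, G, G', u, s) \<in> trans A" "(p, a, H, H', v, t) \<in> trans B"
      and g: "\<forall>r\<in>G. d \<in> f r" "\<forall>r\<in>G'. d \<notin> f r" "\<forall>r\<in>H. d \<in> g r" "\<forall>r\<in>H'. d \<notin> g r"
      and c: "c = ((s, t), join_val (regs A) (regs B) (update (regs A) u d f) (update (regs B) v d g))"
      unfolding Pair step_iff by blast
    have "((q, p), a, G <+> H, G' <+> H', join_up (regs A) (regs B) u v, (s, t)) \<in> trans (inter_rsa A B)"
      unfolding inter_rsa_def rsa.simps using tr by blast
    then have "step (inter_rsa A B) ((q, p), join_val (regs A) (regs B) f g) (a, d)
        ((s, t), update (regs (inter_rsa A B)) (join_up (regs A) (regs B) u v) d
          (join_val (regs A) (regs B) f g))"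
      by (rule step.intros) (use g guards[OF tr] in blast)+
    then show ?L by (simp add: Pair c update_join inter_rsa_def)
  qed
qed

lemma accepts_inter:
  assumes "is_rsa A" "is_rsa B"
  shows "accepts (inter_rsa A B) w ((q, p), join_val (regs A) (regs B) f g) \<longleftrightarrow>
    accepts A w (q, f) \<and> accepts B w (p, g)"
proof (induction w arbitrary: q p f g)
  case Nil
  then show ?case by (simp add: inter_rsa_def)
next
  case (Cons x w)
  show ?case
    using Cons.IH by (simp add: step_inter[OF assms]) blast
qed

lemma lang_inter:
  assumes "is_rsa A" "is_rsa B"
  shows "lang (inter_rsa A B) = lang A \<inter> lang B"
proof -
  have "init (inter_rsa A B) = init A \<times> init B" "regs (inter_rsa A B) = regs A <+> regs B"
    by (simp_all add: inter_rsa_def)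
  then show ?thesis
    by (auto simp: lang_eq_accepts join_val_empty(1) accepts_inter[OF assms])
qed

section \<open>Union\<close>

text \<open>The choice of the initial state fixes the tag for the whole run. The registers of the
  other automaton get no sources, so they stay empty.\<close>

definition union_rsa ::
  "('q, 'r, 'a) rsa \<Rightarrow> ('p, 's, 'a) rsa \<Rightarrow> ('q + 'p, 'r + 's, 'a) rsa" where
  "union_rsa A B =
     \<lparr>states = states A <+> states B, regs = regs A <+> regs B,
      trans = {(Inl q, a, G <+> {}, G' <+> {}, join_up (regs A) (regs B) u (\<lambda>_. {}), Inl s)
          | q a G G' u s. (q, a, G, G', u, s) \<in> trans A}
        \<union> {(Inr p, a, {} <+> H, {} <+> H', join_up (regs A) (regs B) (\<lambda>_. {}) v, Inr t)
          | p a H H' v t. (p, a, H, H', v, t) \<in> trans B},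
      init = init A <+> init B, final = final A <+> final B\<rparr>"

lemma is_rsa_union:
  assumes "is_rsa A" "is_rsa B"
  shows "is_rsa (union_rsa A B)"
proof -
  let ?U = "union_rsa A B"
  have "case x of (q, a, Gin, Gnotin, up, s) \<Rightarrow>
        q \<in> states ?U \<and> s \<in> states ?U \<and> Gin \<subseteq> regs ?U \<and> Gnotin \<subseteq> regs ?U \<and> Gin \<inter> Gnotin = {} \<and>
        up \<in> regs ?U \<rightarrow>\<^sub>E Pow (Reg ` regs ?U \<union> {In})"
    if "x \<in> trans ?U" for x
  proof -
    consider (left) q a G G' u s where "(q, a, G, G', u, s) \<in> trans A"
        "x = (Inl q, a, G <+> {}, G' <+> {}, join_up (regs A) (regs B) u (\<lambda>_. {}), Inl s)"
      | (right) p a H H' v t where "(p, a, H, H', v, t) \<in> trans B"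
        "x = (Inr p, a, {} <+> H, {} <+> H', join_up (regs A) (regs B) (\<lambda>_. {}) v, Inr t)"
      using \<open>x \<in> trans ?U\<close> by (auto simp: union_rsa_def)
    then show ?thesis
    proof cases
      case left
      note w = transD[OF assms(1) left(1)]
      have "join_up (regs A) (regs B) u (\<lambda>_. {})
          \<in> regs A <+> regs B \<rightarrow>\<^sub>E Pow (Reg ` (regs A <+> regs B) \<union> {In})"
        using w(6) by (intro join_up_PiE) (auto simp: PiE_iff)
      then show ?thesis using w(1-5) left(2) by (auto simp: union_rsa_def)
    next
      case right
      note w = transD[OF assms(2) right(1)]
      have "join_up (regs A) (regs B) (\<lambda>_. {}) v
          \<in> regs A <+> regs B \<rightarrow>\<^sub>E Pow (Reg ` (regs A <+> regs B) \<union> {In})"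
        using w(6) by (intro join_up_PiE) (auto simp: PiE_iff)
      then show ?thesis using w(1-5) right(2) by (auto simp: union_rsa_def)
    qed
  qed
  moreover have "finite (states ?U)" "finite (regs ?U)" "init ?U \<subseteq> states ?U" "final ?U \<subseteq> states ?U"
    using assms by (auto simp: is_rsa_def union_rsa_def)
  ultimately show ?thesis unfolding is_rsa_def by blast
qed

text \<open>A register without sources becomes empty. The idle half is therefore again constantly
  \<open>{}\<close> on its registers, so the form of the valuation is an invariant.\<close>

lemma update_join_empty:
  "update (R <+> S) (join_up R S u (\<lambda>_. {})) d (join_val R S f (\<lambda>_. {}))
    = join_val R S (update R u d f) (\<lambda>_. {})"
  "update (R <+> S) (join_up R S (\<lambda>_. {}) v) d (join_val R S (\<lambda>_. {}) g)
    = join_val R S (\<lambda>_. {}) (update S v d g)"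
  unfolding update_join by (rule join_val_cong; simp add: update_def)+

text \<open>Transitions leaving a left-tagged state are copies of those of \<open>A\<close>: they
  test registers of \<open>A\<close> only and keep both the tag and the empty right half.\<close>

lemma step_union_Inl:
  assumes "is_rsa A"
  shows "step (union_rsa A B) (Inl q, join_val (regs A) (regs B) f (\<lambda>_. {})) x c \<longleftrightarrow>
    (\<exists>s f'. step A (q, f) x (s, f') \<and> c = (Inl s, join_val (regs A) (regs B) f' (\<lambda>_. {})))"
    (is "?L \<longleftrightarrow> ?R")
proof (cases x)
  case (Pair a d)
  have guards: "(\<forall>r\<in>G <+> {}. d \<in> join_val (regs A) (regs B) f (\<lambda>_. {}) r) \<longleftrightarrow> (\<forall>r\<in>G. d \<in> f r)"
      "(\<forall>r\<in>G' <+> {}. d \<notin> join_val (regs A) (regs B) f (\<lambda>_. {}) r) \<longleftrightarrow> (\<forall>r\<in>G'. d \<notin> f r)"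
    if "(q, a, G, G', u, s) \<in> trans A" for G G' u s
    using transD(3,4)[OF assms that] by (auto simp: subset_iff)
  show ?thesis
  proof
    assume ?L
    then obtain G G' u s where tr: "(q, a, G, G', u, s) \<in> trans A"
      and g: "\<forall>r\<in>G <+> {}. d \<in> join_val (regs A) (regs B) f (\<lambda>_. {}) r"
        "\<forall>r\<in>G' <+> {}. d \<notin> join_val (regs A) (regs B) f (\<lambda>_. {}) r"
      and c: "c = (Inl s, update (regs A <+> regs B) (join_up (regs A) (regs B) u (\<lambda>_. {})) d
        (join_val (regs A) (regs B) f (\<lambda>_. {})))"
      unfolding Pair step_iff by (auto simp: union_rsa_def simp del: Plus_simps)
    have "step A (q, f) (a, d) (s, update (regs A) u d f)"
      using tr g guards[OF tr] by (auto intro: step.intros)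
    then show ?R unfolding Pair c update_join_empty by blast
  next
    assume ?R
    then obtain G G' u s where tr: "(q, a, G, G', u, s) \<in> trans A"
      and g: "\<forall>r\<in>G. d \<in> f r" "\<forall>r\<in>G'. d \<notin> f r"
      and c: "c = (Inl s, join_val (regs A) (regs B) (update (regs A) u d f) (\<lambda>_. {}))"
      unfolding Pair step_iff by blast
    have "(Inl q, a, G <+> {}, G' <+> {}, join_up (regs A) (regs B) u (\<lambda>_. {}), Inl s)
        \<in> trans (union_rsa A B)"
      unfolding union_rsa_def rsa.simps using tr by blast
    then have "step (union_rsa A B) (Inl q, join_val (regs A) (regs B) f (\<lambda>_. {})) (a, d)
        (Inl s, update (regs (union_rsa A B)) (join_up (regs A) (regs B) u (\<lambda>_. {})) d
          (join_val (regs A) (regs B) f (\<lambda>_. {})))"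
      by (rule step.intros) (use g guards[OF tr] in blast)+
    then show ?L by (simp add: Pair c update_join_empty union_rsa_def)
  qed
qed

lemma step_union_Inr:
  assumes "is_rsa B"
  shows "step (union_rsa A B) (Inr p, join_val (regs A) (regs B) (\<lambda>_. {}) g) x c \<longleftrightarrow>
    (\<exists>t g'. step B (p, g) x (t, g') \<and> c = (Inr t, join_val (regs A) (regs B) (\<lambda>_. {}) g'))"
    (is "?L \<longleftrightarrow> ?R")
proof (cases x)
  case (Pair a d)
  have guards: "(\<forall>r\<in>{} <+> H. d \<in> join_val (regs A) (regs B) (\<lambda>_. {}) g r) \<longleftrightarrow> (\<forall>r\<in>H. d \<in> g r)"
      "(\<forall>r\<in>{} <+> H'. d \<notin> join_val (regs A) (regs B) (\<lambda>_. {}) g r) \<longleftrightarrow> (\<forall>r\<in>H'. d \<notin> g r)"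
    if "(p, a, H, H', v, t) \<in> trans B" for H H' v t
    using transD(3,4)[OF assms that] by (auto simp: subset_iff)
  show ?thesis
  proof
    assume ?L
    then obtain H H' v t where tr: "(p, a, H, H', v, t) \<in> trans B"
      and g: "\<forall>r\<in>{} <+> H. d \<in> join_val (regs A) (regs B) (\<lambda>_. {}) g r"
        "\<forall>r\<in>{} <+> H'. d \<notin> join_val (regs A) (regs B) (\<lambda>_. {}) g r"
      and c: "c = (Inr t, update (regs A <+> regs B) (join_up (regs A) (regs B) (\<lambda>_. {}) v) d
        (join_val (regs A) (regs B) (\<lambda>_. {}) g))"
      unfolding Pair step_iff by (auto simp: union_rsa_def simp del: Plus_simps)
    have "step B (p, g) (a, d) (t, update (regs B) v d g)"
      using tr g guards[OF tr] by (auto intro: step.intros)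
    then show ?R unfolding Pair c update_join_empty by blast
  next
    assume ?R
    then obtain H H' v t where tr: "(p, a, H, H', v, t) \<in> trans B"
      and g: "\<forall>r\<in>H. d \<in> g r" "\<forall>r\<in>H'. d \<notin> g r"
      and c: "c = (Inr t, join_val (regs A) (regs B) (\<lambda>_. {}) (update (regs B) v d g))"
      unfolding Pair step_iff by blast
    have "(Inr p, a, {} <+> H, {} <+> H', join_up (regs A) (regs B) (\<lambda>_. {}) v, Inr t)
        \<in> trans (union_rsa A B)"
      unfolding union_rsa_def rsa.simps using tr by blast
    then have "step (union_rsa A B) (Inr p, join_val (regs A) (regs B) (\<lambda>_. {}) g) (a, d)
        (Inr t, update (regs (union_rsa A B)) (join_up (regs A) (regs B) (\<lambda>_. {}) v) d
          (join_val (regs A) (regs B) (\<lambda>_. {}) g))"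
      by (rule step.intros) (use g guards[OF tr] in blast)+
    then show ?L by (simp add: Pair c update_join_empty union_rsa_def)
  qed
qed

lemma accepts_union_Inl:
  assumes "is_rsa A"
  shows "accepts (union_rsa A B) w (Inl q, join_val (regs A) (regs B) f (\<lambda>_. {})) \<longleftrightarrow>
    accepts A w (q, f)"
proof (induction w arbitrary: q f)
  case (Cons x w)
  then show ?case by (simp add: step_union_Inl[OF assms]) blast
qed (auto simp: union_rsa_def)

lemma accepts_union_Inr:
  assumes "is_rsa B"
  shows "accepts (union_rsa A B) w (Inr p, join_val (regs A) (regs B) (\<lambda>_. {}) g) \<longleftrightarrow>
    accepts B w (p, g)"
proof (induction w arbitrary: p g)
  case (Cons x w)
  then show ?case by (simp add: step_union_Inr[OF assms]) blast
qed (auto simp: union_rsa_def)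

lemma lang_union:
  fixes A :: "('q, 'r, 'a) rsa" and B :: "('p, 's, 'a) rsa"
  assumes "is_rsa A" "is_rsa B"
  shows "(lang (union_rsa A B) :: ('a \<times> 'd) list set) = lang A \<union> lang B"
proof -
  have "init (union_rsa A B) = init A <+> init B" "regs (union_rsa A B) = regs A <+> regs B"
    by (simp_all add: union_rsa_def)
  moreover have "accepts (union_rsa A B) w (Inl q, \<lambda>r\<in>regs A <+> regs B. {})
      \<longleftrightarrow> accepts A w (q, \<lambda>r\<in>regs A. {})" for w :: "('a \<times> 'd) list" and q
    by (simp add: join_val_empty(2) accepts_union_Inl[OF assms(1)])
  moreover have "accepts (union_rsa A B) w (Inr p, \<lambda>r\<in>regs A <+> regs B. {})
      \<longleftrightarrow> accepts B w (p, \<lambda>r\<in>regs B. {})" for w :: "('a \<times> 'd) list" and p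
    by (simp add: join_val_empty(3) accepts_union_Inr[OF assms(2)])
  ultimately show ?thesis
    by (simp add: lang_eq_accepts Collect_disj_eq)
qed

section \<open>Words with a data value that occurs exactly once\<close>

definition unique_lang :: "('a \<times> 'd) list set" where
  "unique_lang = {u @ (a, d) # v | u a d v. d \<notin> snd ` set u \<and> d \<notin> snd ` set v}"

text \<open>Register \<open>0\<close> collects the values read so far; in state \<open>1\<close>, register \<open>1\<close> holds the value
  guessed to occur only once.\<close>

definition unique_rsa :: "(nat, nat, 'a) rsa" where
  "unique_rsa =
     \<lparr>states = {0, 1}, regs = {0, 1},
      trans = (\<Union>a. {(0, a, {}, {}, \<lambda>r\<in>{0, 1}. if r = 0 then {Reg 0, In} else {}, 0),
        (0, a, {}, {0}, \<lambda>r\<in>{0, 1}. if r = 0 then {} else {In}, 1),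
        (1, a, {}, {1}, \<lambda>r\<in>{0, 1}. if r = 0 then {} else {Reg 1}, 1)}),
      init = {0}, final = {1}\<rparr>"

lemma is_rsa_unique: "is_rsa unique_rsa"
  by (auto simp: is_rsa_def unique_rsa_def PiE_iff)

definition unique_val :: "'d set \<Rightarrow> 'd set \<Rightarrow> nat \<Rightarrow> 'd set" where
  "unique_val X Y = (\<lambda>r\<in>{0, 1}. if r = 0 then X else Y)"

lemma update_unique:
  "update {0, 1} (\<lambda>r\<in>{0, 1}. if r = 0 then {Reg 0, In} else {}) d (unique_val X Y)
    = unique_val (insert d X) {}"
  "update {0, 1} (\<lambda>r\<in>{0, 1}. if r = 0 then {} else {In}) d (unique_val X Y) = unique_val {} {d}"
  "update {0, 1} (\<lambda>r\<in>{0, 1}. if r = 0 then {} else {Reg 1}) d (unique_val X Y) = unique_val {} Y"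
  by (auto simp: update_def unique_val_def fun_eq_iff)

text \<open>The guess compares the value with the whole past, held in register \<open>0\<close>;
  from then on only later letters have to be compared with register \<open>1\<close>.\<close>

lemma step_unique:
  "step unique_rsa (0, unique_val X Y) (a, d) c \<longleftrightarrow>
    c = (0, unique_val (insert d X) {}) \<or> d \<notin> X \<and> c = (1, unique_val {} {d})"
  "step unique_rsa (1, unique_val X Y) (a, d) c \<longleftrightarrow> d \<notin> Y \<and> c = (1, unique_val {} Y)"
  unfolding update_unique[of d X Y, symmetric] step_iff
  by (auto simp: unique_rsa_def unique_val_def simp del: One_nat_def)

text \<open>State \<open>1\<close> is final and is never left, so only its guard can block the run.
  \<open>X\<close> varies in the induction because the first step empties register
  \<open>0\<close>.\<close>

lemma accepts_unique_1:
  "accepts unique_rsa w (1, unique_val X Y) \<longleftrightarrow> snd ` set w \<inter> Y = {}"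
proof (induction w arbitrary: X)
  case (Cons x w)
  then show ?case by (cases x) (auto simp: step_unique(2) simp del: One_nat_def)
qed (simp add: unique_rsa_def)

text \<open>\<open>X\<close> represents the values read before \<open>w\<close>; it is general
  because each step that stays in state \<open>0\<close> inserts its value. The split of
  \<open>w\<close> marks the letter at which the guess is made.\<close>

lemma accepts_unique_0:
  "accepts unique_rsa w (0, unique_val X Y) \<longleftrightarrow>
    (\<exists>u a d v. w = u @ (a, d) # v \<and> d \<notin> X \<union> snd ` set u \<and> d \<notin> snd ` set v)"
proof (induction w arbitrary: X Y)
  case (Cons x w)
  obtain a d where x: "x = (a, d)" by force
  \<comment> \<open>Either the first letter is collected and the guess comes later, or the first
    letter is itself the guess.\<close>
  have "accepts unique_rsa (x # w) (0, unique_val X Y) \<longleftrightarrow>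
      (\<exists>u b e v. w = u @ (b, e) # v \<and> e \<notin> insert d X \<union> snd ` set u \<and> e \<notin> snd ` set v) \<or>
      d \<notin> X \<and> d \<notin> snd ` set w"
    by (simp add: x step_unique(1) conj_disj_distribR ex_disj_distrib Cons.IH accepts_unique_1
        del: One_nat_def split_paired_Ex)
  also have "\<dots> \<longleftrightarrow>
      (\<exists>u b e v. x # w = u @ (b, e) # v \<and> e \<notin> X \<union> snd ` set u \<and> e \<notin> snd ` set v)"
    (is "?L \<longleftrightarrow> ?R")
  proof
    assume ?L
    then show ?R
    proof (elim disjE exE conjE)
      fix u b e v
      assume "w = u @ (b, e) # v" "e \<notin> insert d X \<union> snd ` set u" "e \<notin> snd ` set v"
      then show ?R by (intro exI[of _ "x # u"] exI[of _ b] exI[of _ e] exI[of _ v]) (auto simp: x)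
    next
      assume "d \<notin> X" "d \<notin> snd ` set w"
      then show ?R by (intro exI[of _ "[]"] exI[of _ a] exI[of _ d] exI[of _ w]) (auto simp: x)
    qed
  next
    assume ?R
    then obtain u b e v where *: "x # w = u @ (b, e) # v" "e \<notin> X \<union> snd ` set u" "e \<notin> snd ` set v"
      by blast
    show ?L
    proof (cases u)
      case Nil
      then show ?L using * x by auto
    next
      case (Cons y u')
      then have "w = u' @ (b, e) # v" "e \<notin> insert d X \<union> snd ` set u'" using * x by auto
      then show ?L using *(3) by blast
    qed
  qed
  finally show ?case .
qed (simp add: unique_rsa_def)

lemma lang_unique: "(lang unique_rsa :: ('a \<times> 'd) list set) = unique_lang"
proof -
  have "init (unique_rsa :: (nat, nat, 'a) rsa) = {0}" "regs (unique_rsa :: (nat, nat, 'a) rsa) = {0, 1}"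
    by (simp_all add: unique_rsa_def)
  moreover have "(\<lambda>r\<in>{0, 1}. {} :: 'd set) = unique_val {} {}" by (auto simp: unique_val_def)
  ultimately show ?thesis
    by (simp add: lang_eq_accepts accepts_unique_0 unique_lang_def del: One_nat_def)
qed

section \<open>Transporting runs along type-preserving injections\<close>

text \<open>The word is written in names from \<open>D\<close>, interpreted as data by
  \<open>e\<close> or \<open>e'\<close>. Guards see a value only through the registers that contain
  it, so the same transitions remain enabled as long as the two interpretations have equal
  types.\<close>

lemma accepts_transport:
  assumes "is_rsa B" "inj_on e D" "inj_on e' D" "snd ` set w \<subseteq> D"
    and "\<And>i r. i \<in> D \<Longrightarrow> r \<in> regs B \<Longrightarrow> e i \<in> f r \<longleftrightarrow> e' i \<in> f' r"
    and "accepts B (map (apsnd e) w) (q, f)"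
  shows "accepts B (map (apsnd e') w) (q, f')"
  using assms(4-)
proof (induction w arbitrary: q f f')
  case (Cons x w)
  obtain a i where x: "x = (a, i)" by force
  then have i: "i \<in> D" using Cons.prems(1) by simp
  obtain s g where st: "step B (q, f) (a, e i) (s, g)" and acc: "accepts B (map (apsnd e) w) (s, g)"
    using Cons.prems(3) x by auto
  from st obtain Gin Gnotin up where tr: "(q, a, Gin, Gnotin, up, s) \<in> trans B"
    and guards: "\<forall>r\<in>Gin. e i \<in> f r" "\<forall>r\<in>Gnotin. e i \<notin> f r"
    and g: "g = update (regs B) up (e i) f"
    by (auto simp: step_iff)
  have "step B (q, f') (a, e' i) (s, update (regs B) up (e' i) f')"
    using tr
  proof (rule step.intros)
    show "\<forall>r\<in>Gin. e' i \<in> f' r" "\<forall>r\<in>Gnotin. e' i \<notin> f' r"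
      using guards Cons.prems(2)[OF i] transD(3,4)[OF assms(1) tr] by blast+
  qed
  moreover have "accepts B (map (apsnd e') w) (s, update (regs B) up (e' i) f')"
  proof (rule Cons.IH[OF _ _ acc])
    fix j r assume j: "j \<in> D" and r: "r \<in> regs B"
    \<comment> \<open>The value just read is the only one that \<open>In\<close> can add, so
      injectivity is what keeps the types of all other names equal.\<close>
    have "e j = e i \<longleftrightarrow> e' j = e' i" using i j assms(2,3) by (auto dest: inj_onD)
    then show "e j \<in> g r \<longleftrightarrow> e' j \<in> update (regs B) up (e' i) f' r"
      using Cons.prems(2)[OF j] by (auto simp: g mem_update[OF r])
  qed (use Cons.prems(1) in auto)
  ultimately show ?case using x by auto
qed simp

section \<open>Dickson's lemma\<close>

text \<open>Every sequence has a monotone subsequence, and a nonincreasing one of natural numbers is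
  eventually constant.\<close>

lemma nat_seq_mono_subseq:
  fixes s :: "nat \<Rightarrow> nat"
  obtains g :: "nat \<Rightarrow> nat" where "strict_mono g" "mono (\<lambda>i. s (g i))"
proof -
  obtain g :: "nat \<Rightarrow> nat" where g: "strict_mono g" "monoseq (\<lambda>i. s (g i))"
    using seq_monosub[of s] by blast
  show ?thesis
  proof (cases "\<forall>m n. m \<le> n \<longrightarrow> s (g m) \<le> s (g n)")
    case True
    then show ?thesis using that[of g] g by (simp add: mono_def)
  next
    case False
    then have dec: "s (g n) \<le> s (g m)" if "m \<le> n" for m n
      using g(2) that unfolding monoseq_def by blast
    \<comment> \<open>From an index where the minimum is attained, the nonincreasing sequence is
      constant.\<close>
    obtain N where N: "s (g N) \<le> s (g n)" for n
      using ex_has_least_nat[of "\<lambda>_. True" _ "\<lambda>i. s (g i)"] by blast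
    have "s (g (N + i)) = s (g N)" for i
      using N dec[of N "N + i"] by (simp add: le_antisym)
    then show ?thesis
      using that[of "\<lambda>i. g (N + i)"] g(1) by (simp add: strict_mono_def mono_def)
  qed
qed

text \<open>Coordinates are treated one at a time: passing to a further subsequence preserves
  monotonicity in the earlier ones.\<close>

lemma dickson_subseq:
  fixes k :: "nat \<Rightarrow> 't \<Rightarrow> nat"
  assumes "finite T"
  shows "\<exists>h :: nat \<Rightarrow> nat. strict_mono h \<and> (\<forall>t\<in>T. mono (\<lambda>i. k (h i) t))"
  using assms
proof induction
  case empty
  then show ?case by (auto intro: strict_mono_id[unfolded id_def])
next
  case (insert t T)
  then obtain h :: "nat \<Rightarrow> nat" where h: "strict_mono h" "\<forall>t\<in>T. mono (\<lambda>i. k (h i) t)" by blast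
  obtain g :: "nat \<Rightarrow> nat" where g: "strict_mono g" "mono (\<lambda>i. k (h (g i)) t)"
    using nat_seq_mono_subseq[of "\<lambda>i. k (h i) t"] by blast
  have "strict_mono (h \<circ> g)" using h g by (simp add: strict_mono_o)
  moreover have "mono (\<lambda>i. k ((h \<circ> g) i) t')" if "t' \<in> insert t T" for t'
    using that h g by (auto simp: mono_def strict_mono_less_eq)
  ultimately show ?case by blast
qed

text \<open>The cardinalities give an injection on each class separately. These combine into one
  because \<open>\<tau>\<close> of an image recovers the class it came from.\<close>

lemma inj_on_preserving_classes:
  assumes "finite J" "\<And>i. i \<in> I \<Longrightarrow> finite {i'\<in>I. \<sigma> i' = \<sigma> i}"
    and "\<And>i. i \<in> I \<Longrightarrow> card {i'\<in>I. \<sigma> i' = \<sigma> i} \<le> card {j\<in>J. \<tau> j = \<sigma> i}"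
  obtains p where "inj_on p I" "\<And>i. i \<in> I \<Longrightarrow> p i \<in> J \<and> \<tau> (p i) = \<sigma> i"
proof -
  have "\<exists>p. inj_on p {i\<in>I. \<sigma> i = t} \<and> p ` {i\<in>I. \<sigma> i = t} \<subseteq> {j\<in>J. \<tau> j = t}"
    if t: "t \<in> \<sigma> ` I" for t
  proof -
    obtain i where i: "i \<in> I" "t = \<sigma> i" using t by blast
    have "finite {j\<in>J. \<tau> j = t}" using assms(1) by simp
    from card_le_inj[OF assms(2)[OF i(1)] this[unfolded i(2)] assms(3)[OF i(1)]] show ?thesis
      unfolding i(2) by blast
  qed
  then have "\<exists>p. \<forall>t\<in>\<sigma> ` I. inj_on (p t) {i\<in>I. \<sigma> i = t} \<and> p t ` {i\<in>I. \<sigma> i = t} \<subseteq> {j\<in>J. \<tau> j = t}"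
    by (intro bchoice ballI)
  then obtain p where p: "\<And>t. t \<in> \<sigma> ` I \<Longrightarrow> inj_on (p t) {i\<in>I. \<sigma> i = t}"
    "\<And>t. t \<in> \<sigma> ` I \<Longrightarrow> p t ` {i\<in>I. \<sigma> i = t} \<subseteq> {j\<in>J. \<tau> j = t}"
    by blast
  have q: "p (\<sigma> i) i \<in> J \<and> \<tau> (p (\<sigma> i) i) = \<sigma> i" if "i \<in> I" for i
    using p(2)[of "\<sigma> i"] that by blast
  show ?thesis
  proof (rule that[of "\<lambda>i. p (\<sigma> i) i"])
    show "inj_on (\<lambda>i. p (\<sigma> i) i) I"
    proof (rule inj_onI)
      fix i j assume ij: "i \<in> I" "j \<in> I" "p (\<sigma> i) i = p (\<sigma> j) j"
      then have "\<sigma> i = \<sigma> j" using q[of i] q[of j] by simp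
      then show "i = j" using inj_onD[OF p(1)[of "\<sigma> i"], of i j] ij by simp
    qed
  qed (use q in blast)
qed

section \<open>Failure of closure under complement\<close>

lemma unique_langI:
  assumes "m \<notin> snd ` set v" "distinct (map snd u)" "m \<in> snd ` set u"
  shows "u @ v \<in> unique_lang"
proof -
  obtain x where "x \<in> set u" "m = snd x" using assms(3) by auto
  then obtain u1 u2 where "u = u1 @ x # u2" by (meson split_list)
  then have "u @ v = u1 @ (fst x, m) # (u2 @ v)" "m \<notin> snd ` set u1" "m \<notin> snd ` set (u2 @ v)"
    using assms \<open>m = snd x\<close> by auto
  then show ?thesis unfolding unique_lang_def by blast
qed

lemma not_unique_langI:
  assumes "\<And>x. x \<in> set u \<Longrightarrow> snd x \<in> snd ` set v" "\<And>x. x \<in> set v \<Longrightarrow> snd x \<in> snd ` set u"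
  shows "u @ v \<notin> unique_lang"
proof
  assume "u @ v \<in> unique_lang"
  then obtain u' a d v' where *: "u @ v = u' @ (a, d) # v'" "d \<notin> snd ` set u'" "d \<notin> snd ` set v'"
    by (auto simp: unique_lang_def)
  then have "d \<in> snd ` (set u \<union> set v)"
    by (metis in_set_conv_decomp set_append snd_conv image_eqI)
  then have d: "d \<in> snd ` set u" "d \<in> snd ` set v" using assms by auto
  \<comment> \<open>The single occurrence lies in one half, and \<open>d\<close> also occurs in the
    other half, hence in \<open>u'\<close> or in \<open>v'\<close>.\<close>
  from *(1) consider us where "u = u' @ us" "us @ v = (a, d) # v'"
    | us where "u @ us = u'" "v = us @ (a, d) # v'"
    by (auto simp: append_eq_append_conv2)
  then show False
  proof cases
    case 1
    then show False
      using *(2,3) d by (cases us) auto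
  next
    case 2
    then show False using *(2) d by auto
  qed
qed

lemma not_rsa_lang_compl_unique:
  assumes "infinite (UNIV :: 'd set)" and B: "is_rsa B"
  shows "lang B \<noteq> UNIV - (unique_lang :: ('a \<times> 'd) list set)"
proof
  assume L: "lang B = UNIV - (unique_lang :: ('a \<times> 'd) list set)"
  obtain e :: "nat \<Rightarrow> 'd" where e: "inj e"
    using assms(1) infinite_countable_subset by blast
  \<comment> \<open>All positions carry one arbitrary letter. The data are indices, so that the same
    word can be read through \<open>e\<close> or through \<open>e \<circ> p\<close>.\<close>
  define w :: "nat \<Rightarrow> ('a \<times> nat) list" where "w n = map (Pair undefined) [0..<n]" for n
  have sw: "snd ` set (w n) = {..<n}" for n by (auto simp: w_def image_image)
  have "\<exists>c0 q f. c0 \<in> initial_configs B \<and> run B c0 (map (apsnd e) (w n)) (q, f) \<and>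
      accepts B (map (apsnd e) (w n)) (q, f)" for n
  proof -
    have "map (apsnd e) (w n) @ map (apsnd e) (w n) \<notin> unique_lang"
      by (rule not_unique_langI) auto
    then have "map (apsnd e) (w n) @ map (apsnd e) (w n) \<in> lang B"
      using L by blast
    then show ?thesis
      by (auto simp: lang_eq_accepts accepts_append initial_configs_def)
  qed
  then obtain c0 q f where c0: "\<And>n. c0 n \<in> initial_configs B"
    and run: "\<And>n. run B (c0 n) (map (apsnd e) (w n)) (q n, f n)"
    and acc: "\<And>n. accepts B (map (apsnd e) (w n)) (q n, f n)"
    by metis
  have "init B \<subseteq> states B" and fin: "finite (states B)" "finite (regs B)"
    using B by (auto simp: is_rsa_def)
  then have "fst (c0 n) \<in> states B" for n
    using c0[of n] by (auto simp: initial_configs_def)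
  then have q: "q n \<in> states B" for n
    using run_states[OF run B] by simp
  \<comment> \<open>This is the type of the value \<open>e i\<close> after the first half for
    \<open>n\<close>.\<close>
  define ty where "ty n i = {r \<in> regs B. e i \<in> f n r}" for n i
  \<comment> \<open>The successor makes comparability of the counts at \<open>q n\<close> force equality of the states.\<close>
  define k where
    "k n = (\<lambda>(p, t). if p = q n then Suc (card {i\<in>{..<n}. ty n i = t}) else 0)" for n
  \<comment> \<open>Pairs of a state and a type form a finite set of coordinates, so Dickson's lemma
    applies to the vectors \<open>k n\<close>.\<close>
  obtain h :: "nat \<Rightarrow> nat" where h: "strict_mono h" "\<forall>x\<in>states B \<times> Pow (regs B). mono (\<lambda>i. k (h i) x)"
    using dickson_subseq[of "states B \<times> Pow (regs B)" k] fin by auto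
  define n m where "n = h 0" and "m = h 1"
  have nm: "n < m" using h(1) by (simp add: n_def m_def strict_mono_def)
  have k: "k n (q n, t) \<le> k m (q n, t)" if "t \<subseteq> regs B" for t
    using h(2) q[of n] that unfolding n_def m_def by (auto simp: mono_def)
  \<comment> \<open>Any type would do here: \<open>k n (q n, {})\<close> is positive, hence so is
    \<open>k m (q n, {})\<close>, which forces the states to agree.\<close>
  have qq: "q m = q n" using k[of "{}"] by (simp add: k_def split: if_splits)
  then have "card {i\<in>{..<n}. ty n i = t} \<le> card {i\<in>{..<m}. ty m i = t}" if "t \<subseteq> regs B" for t
    using k[OF that] by (simp add: k_def)
  then obtain p where p: "inj_on p {..<n}" "\<And>i. i < n \<Longrightarrow> p i < m \<and> ty m (p i) = ty n i"
    using inj_on_preserving_classes[of "{..<m}" "{..<n}" "ty n" "ty m"]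
    by (auto simp: ty_def)
  \<comment> \<open>The value \<open>e (p i)\<close> has the same type in \<open>f m\<close> as
    \<open>e i\<close> has in \<open>f n\<close>, so the second half for \<open>n\<close> can be
    transported.\<close>
  have "accepts B (map (apsnd (e \<circ> p)) (w n)) (q n, f m)"
  proof (rule accepts_transport[OF B _ _ _ _ acc])
    show "inj_on e {..<n}" using e by (simp add: inj_on_def)
    show "inj_on (e \<circ> p) {..<n}" using e p(1) by (auto simp: inj_on_def)
    fix i r assume "i \<in> {..<n}" "r \<in> regs B"
    then show "e i \<in> f n r \<longleftrightarrow> (e \<circ> p) i \<in> f m r"
      using p(2)[of i] by (auto simp: ty_def set_eq_iff)
  qed (simp add: sw)
  then have "accepts B (map (apsnd e) (w m) @ map (apsnd (e \<circ> p)) (w n)) (c0 m)"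
    using run[of m] by (auto simp: accepts_append qq)
  then have "map (apsnd e) (w m) @ map (apsnd (e \<circ> p)) (w n) \<in> lang B"
    using c0[of m] by (auto simp: lang_eq_accepts initial_configs_def)
  moreover have "map (apsnd e) (w m) @ map (apsnd (e \<circ> p)) (w n) \<in> unique_lang"
  proof -
    \<comment> \<open>The renamed second half uses at most \<open>n < m\<close> values, so some
      \<open>e j\<close> from the first half is not repeated.\<close>
    have "card (p ` {..<n}) < card {..<m}"
      using nm card_image_le[of "{..<n}" p] by simp
    then obtain j where j: "j < m" "j \<notin> p ` {..<n}"
      by (metis card_mono finite_imageI finite_lessThan lessThan_iff linorder_not_le subsetI)
    show ?thesis
    proof (rule unique_langI)
      show "e j \<notin> snd ` set (map (apsnd (e \<circ> p)) (w n))"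
        using j(2) by (auto simp: w_def inj_eq[OF e])
      show "distinct (map snd (map (apsnd e) (w m)))"
        using e by (auto simp: w_def distinct_map comp_def intro: inj_on_subset)
      show "e j \<in> snd ` set (map (apsnd e) (w m))"
        using j(1) by (force simp: w_def)
    qed
  qed
  ultimately show False using L by blast
qed

theorem theorem4p3:
  assumes "infinite (UNIV :: 'd set)"
  shows "(\<forall>L1 \<in> rsa_langs :: ('a::finite \<times> 'd) list set set. \<forall>L2 \<in> rsa_langs. L1 \<union> L2 \<in> rsa_langs)
    \<and> (\<forall>L1 \<in> rsa_langs :: ('a \<times> 'd) list set set. \<forall>L2 \<in> rsa_langs. L1 \<inter> L2 \<in> rsa_langs)
    \<and> (\<exists>A :: (nat, nat, 'a) rsa. is_rsa A \<and>
        \<not> (\<exists>B :: (nat, nat, 'a) rsa. is_rsa B \<and> lang B = UNIV - (lang A :: ('a \<times> 'd) list set)))"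
proof (intro conjI ballI)
  fix L1 L2 :: "('a \<times> 'd) list set" assume "L1 \<in> rsa_langs" "L2 \<in> rsa_langs"
  then obtain A B :: "(nat, nat, 'a) rsa" where
    AB: "is_rsa A" "is_rsa B" and L: "L1 = lang A" "L2 = lang B"
    by (auto simp: rsa_langs_def)
  \<comment> \<open>The constructions use sum and product types; \<open>lang_in_rsa_langs\<close>
    brings their languages back to automata over \<open>nat\<close>.\<close>
  show "L1 \<union> L2 \<in> rsa_langs"
    using lang_in_rsa_langs[OF is_rsa_union[OF AB]] by (simp add: L lang_union[OF AB])
  show "L1 \<inter> L2 \<in> rsa_langs"
    using lang_in_rsa_langs[OF is_rsa_inter[OF AB]] by (simp add: L lang_inter[OF AB])
next
  show "\<exists>A :: (nat, nat, 'a) rsa. is_rsa A \<and>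
      \<not> (\<exists>B :: (nat, nat, 'a) rsa. is_rsa B \<and> lang B = UNIV - (lang A :: ('a \<times> 'd) list set))"
    using is_rsa_unique not_rsa_lang_compl_unique[OF assms] lang_unique by metis
qed

end
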